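(* Let $C$ be a nonempty closed convex subset of a real Hilbert space $H$. Let $\{f_i\}_{i=1}^N$ be a finite family of bifunctions on $C$ satisfying conditions A1--A4 (listed in the context), with A2 holding with common constants $c_1,c_2>0$, and let $\{S_j\}_{j=1}^M$ be a finite family of nonexpansive mappings $S_j:C\to C$. Suppose that the set $F=\left(\bigcap_{i=1}^N EP(f_i)\right)\cap\left(\bigcap_{j=1}^M F(S_j)\right)$ is nonempty. Let $x_0\in C$, $0<\rho<\min\left\{\frac{1}{2c_1},\frac{1}{2c_2}\right\}$, and let $\{\alpha_n\}_{n\ge 0}\subset(0,1)$ satisfy $\lim_{n\to\infty}\alpha_n=0$. Then the sequence $\{x_n\}$ generated by the parallel hybrid Halpern-extragradient method (described in the context) converges strongly to $x^\dagger=P_F x_0$.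
   Context: A bifunction on $C$ is a function $f:C\times C\to\mathbb{R}\cup\{+\infty\}$ with $f(x,x)=0$ for all $x\in C$. $EP(f)=\{x^*\in C: f(x^*,y)\ge 0\ \forall y\in C\}$. A mapping $S:C\to C$ is nonexpansive if $\|Sx-Sy\|\le\|x-y\|$ for all $x,y\in C$; $F(S)$ is its set of fixed points. $P_D$ denotes the metric projection onto a nonempty closed convex set $D$. Conditions on a bifunction $f$: A1. $f$ is pseudomonotone: for all $x,y\in C$, $f(x,y)\ge 0\Rightarrow f(y,x)\le 0$. A2. $f$ is Lipschitz-type continuous: there are constants $c_1,c_2>0$ such that $f(x,y)+f(y,z)\ge f(x,z)-c_1\|x-y\|^2-c_2\|y-z\|^2$ for all $x,y,z\in C$. (For a finite family, common constants $c_1,c_2$ are used, obtained by taking maxima.) A3. $f$ is weakly continuous on $C\times C$: if $x_n\rightharpoonup x$ and $y_n\rightharpoonup y$ in $C$, then $f(x_n,y_n)\to f(x,y)$. A4. $f(x,\cdot)$ is convex and subdifferentiable on $C$ for every fixed $x\in C$. Parallel hybrid Halpern-extragradient method. Starting with $x_0\in C$, for $n=0,1,2,\dots$ (no stopping rule): 1. $y_n^i=\operatorname{argmin}\{\rho f_i(x_n,y)+\frac12\|x_n-y\|^2: y\in C\}$, $i=1,\dots,N$. 2. $z_n^i=\operatorname{argmin}\{\rho f_i(y_n^i,y)+\frac12\|x_n-y\|^2: y\in C\}$, $i=1,\dots,N$. 3. Choose $i_n\in\operatorname{argmax}\{\|z_n^i-x_n\|: i=1,\dots,N\}$ and set $\bar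 z_n:=z_n^{i_n}$. 4. $u_n^j=\alpha_n x_0+(1-\alpha_n)S_j\bar z_n$, $j=1,\dots,M$. 5. Choose $j_n\in\operatorname{argmax}\{\|u_n^j-x_n\|: j=1,\dots,M\}$ and set $\bar u_n:=u_n^{j_n}$. 6. $C_n=\{v\in C:\|\bar u_n-v\|^2\le\alpha_n\|x_0-v\|^2+(1-\alpha_n)\|x_n-v\|^2\}$ and $Q_n=\{v\in C:\langle x_0-x_n,v-x_n\rangle\le 0\}$. 7. $x_{n+1}=P_{C_n\cap Q_n}(x_0)$. *)

theory Defs
  imports "HOL-Analysis.Analysis"
begin

text \<open>
  A real Hilbert space is a type of sort \<open>{real_inner, complete_space}\<close>. Bifunctions on \<open>C\<close> with
  values in the reals extended by \<open>+\<infinity>\<close> are \<open>ereal\<close>-valued and required to avoid \<open>-\<infinity>\<close>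
  on \<open>C \<times> C\<close>; their values outside \<open>C \<times> C\<close> are irrelevant.
\<close>

definition bifunction_on :: "'a set \<Rightarrow> ('a \<Rightarrow> 'a \<Rightarrow> ereal) \<Rightarrow> bool" where
  "bifunction_on C f \<longleftrightarrow> (\<forall>x\<in>C. \<forall>y\<in>C. f x y \<noteq> -\<infinity>) \<and> (\<forall>x\<in>C. f x x = 0)"

definition equilibria :: "'a set \<Rightarrow> ('a \<Rightarrow> 'a \<Rightarrow> ereal) \<Rightarrow> 'a set" where
  "equilibria C f = {x \<in> C. \<forall>y\<in>C. f x y \<ge> 0}"

definition nonexpansive_on :: "'a::real_normed_vector set \<Rightarrow> ('a \<Rightarrow> 'a) \<Rightarrow> bool" where
  "nonexpansive_on C S \<longleftrightarrow> S ` C \<subseteq> C \<and> (\<forall>x\<in>C. \<forall>y\<in>C. norm (S x - S y) \<le> norm (x - y))"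

definition fixed_points_on :: "'a set \<Rightarrow> ('a \<Rightarrow> 'a) \<Rightarrow> 'a set" where
  "fixed_points_on C S = {x \<in> C. S x = x}"

definition pseudomonotone_on :: "'a set \<Rightarrow> ('a \<Rightarrow> 'a \<Rightarrow> ereal) \<Rightarrow> bool" where
  "pseudomonotone_on C f \<longleftrightarrow> (\<forall>x\<in>C. \<forall>y\<in>C. f x y \<ge> 0 \<longrightarrow> f y x \<le> 0)"

definition lipschitz_type_on ::
  "real \<Rightarrow> real \<Rightarrow> 'a::real_normed_vector set \<Rightarrow> ('a \<Rightarrow> 'a \<Rightarrow> ereal) \<Rightarrow> bool" where
  "lipschitz_type_on c\<^sub>1 c\<^sub>2 C f \<longleftrightarrow>
     (\<forall>x\<in>C. \<forall>y\<in>C. \<forall>z\<in>C.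
        f x y + f y z \<ge> f x z - ereal (c\<^sub>1 * (norm (x - y))\<^sup>2) - ereal (c\<^sub>2 * (norm (y - z))\<^sup>2))"

definition weakly_tendsto :: "(nat \<Rightarrow> 'a::real_inner) \<Rightarrow> 'a \<Rightarrow> bool" where
  "weakly_tendsto X x \<longleftrightarrow> (\<forall>h. (\<lambda>n. inner (X n) h) \<longlonglongrightarrow> inner x h)"

definition weakly_continuous_on :: "'a::real_inner set \<Rightarrow> ('a \<Rightarrow> 'a \<Rightarrow> ereal) \<Rightarrow> bool" where
  "weakly_continuous_on C f \<longleftrightarrow>
     (\<forall>X Y x y. range X \<subseteq> C \<longrightarrow> range Y \<subseteq> C \<longrightarrow> x \<in> C \<longrightarrow> y \<in> C \<longrightarrow>
        weakly_tendsto X x \<longrightarrow> weakly_tendsto Y y \<longrightarrow> (\<lambda>n. f (X n) (Y n)) \<longlonglongrightarrow> f x y)"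

text \<open>
  The library's \<open>convex_on\<close> covers real-valued functions only. At \<open>t = 0\<close> and \<open>t = 1\<close> the
  inequality below is trivial also where \<open>g\<close> is infinite, since \<open>0 * \<infinity> = 0\<close> in \<open>ereal\<close>.
\<close>

definition ereal_convex_on :: "'a::real_vector set \<Rightarrow> ('a \<Rightarrow> ereal) \<Rightarrow> bool" where
  "ereal_convex_on C g \<longleftrightarrow> convex C \<and>
     (\<forall>t\<in>{0..1}. \<forall>y\<in>C. \<forall>z\<in>C.
        g ((1 - t) *\<^sub>R y + t *\<^sub>R z) \<le> ereal (1 - t) * g y + ereal t * g z)"

definition subdifferential_on :: "'a::real_inner set \<Rightarrow> ('a \<Rightarrow> ereal) \<Rightarrow> 'a \<Rightarrow> 'a set" where
  "subdifferential_on C g y = {w. \<forall>z\<in>C. g z \<ge> g y + ereal (inner w (z - y))}"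

definition subdifferentiable_on :: "'a::real_inner set \<Rightarrow> ('a \<Rightarrow> ereal) \<Rightarrow> bool" where
  "subdifferentiable_on C g \<longleftrightarrow> (\<forall>y\<in>C. subdifferential_on C g y \<noteq> {})"

text \<open>
  The library's \<open>closest_point\<close> is restricted to Heine-Borel spaces, hence to finite dimension.
\<close>

definition metric_proj :: "'a::metric_space set \<Rightarrow> 'a \<Rightarrow> 'a" where
  "metric_proj D a = arg_min_on (dist a) D"

lemma parallelogram_midpoint:
  fixes a u v :: "'a::real_inner"
  shows "(dist u v)\<^sup>2 = 2 * (dist a u)\<^sup>2 + 2 * (dist a v)\<^sup>2 - 4 * (dist a (midpoint u v))\<^sup>2"
proof -
  have "a - midpoint u v = (1/2) *\<^sub>R ((a - u) + (a - v))"
    by (simp add: midpoint_def algebra_simps flip: scaleR_add_left)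
  then have "4 * (dist a (midpoint u v))\<^sup>2 = (norm ((a - u) + (a - v)))\<^sup>2"
    by (simp add: dist_norm power2_eq_square)
  moreover have "dist u v = norm ((a - u) - (a - v))"
    by (simp add: dist_norm norm_minus_commute)
  ultimately show ?thesis
    by (simp add: dist_norm power2_norm_eq_inner inner_add inner_diff inner_commute)
qed

text \<open>On nonempty closed convex sets \<open>metric_proj\<close> is the unique nearest point.\<close>

lemma is_arg_min_metric_proj_iff:
  fixes D :: "'a::{real_inner, complete_space} set"
  assumes "closed D" "convex D" "D \<noteq> {}"
  shows "is_arg_min (dist a) (\<lambda>v. v \<in> D) p \<longleftrightarrow> p = metric_proj D a"
proof -
  define d where "d = infdist a D"
  have d0: "d \<ge> 0" by (simp add: d_def infdist_nonneg)
  have dle: "d \<le> dist a v" if "v \<in> D" for v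
    using that by (simp add: d_def infdist_le)
  have close: "(dist u v)\<^sup>2 \<le> 2 * (dist a u)\<^sup>2 + 2 * (dist a v)\<^sup>2 - 4 * d\<^sup>2"
    if "u \<in> D" "v \<in> D" for u v
  proof -
    have "midpoint u v \<in> D"
      using convexD[OF assms(2) that, of "1/2" "1/2"]
      by (simp add: midpoint_def scaleR_add_right)
    then have "d\<^sup>2 \<le> (dist a (midpoint u v))\<^sup>2"
      using dle d0 power_mono by blast
    then show ?thesis using parallelogram_midpoint[of u v a] by linarith
  qed
  have "\<exists>v\<in>D. dist a v < d + 1 / real (Suc n)" for n
  proof (rule ccontr)
    assume "\<not> ?thesis"
    then have "d + 1 / real (Suc n) \<le> infdist a D"
      unfolding infdist_notempty[OF assms(3)]
      by (intro cINF_greatest[OF assms(3)]) force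
    then show False by (simp add: d_def)
  qed
  then obtain v where vD: "\<And>n. v n \<in> D" and v: "\<And>n. dist a (v n) < d + 1 / real (Suc n)"
    by metis
  have lim0: "(\<lambda>n. d + 1 / real (Suc n)) \<longlonglongrightarrow> d + 0"
    by (intro tendsto_add tendsto_const LIMSEQ_Suc[OF lim_1_over_n])
  have lim: "(\<lambda>n. dist a (v n)) \<longlonglongrightarrow> d"
    by (rule tendsto_sandwich[OF _ _ tendsto_const[of d]])
       (use lim0 v dle vD in \<open>auto intro!: always_eventually less_imp_le\<close>)
  have "Cauchy v"
  proof (rule metric_CauchyI)
    fix e :: real assume e: "e > 0"
    have "(\<lambda>n. (dist a (v n))\<^sup>2) \<longlonglongrightarrow> d\<^sup>2" by (intro tendsto_power lim)
    then have "eventually (\<lambda>n. (dist a (v n))\<^sup>2 < d\<^sup>2 + e\<^sup>2 / 4) sequentially"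
      by (rule order_tendstoD(2)) (use e in simp)
    then obtain M where M: "\<And>n. n \<ge> M \<Longrightarrow> (dist a (v n))\<^sup>2 < d\<^sup>2 + e\<^sup>2 / 4"
      by (auto simp: eventually_sequentially)
    show "\<exists>M. \<forall>m\<ge>M. \<forall>n\<ge>M. dist (v m) (v n) < e"
    proof (intro exI allI impI)
      fix m n assume "m \<ge> M" "n \<ge> M"
      then have "(dist (v m) (v n))\<^sup>2 < e\<^sup>2"
        using close[OF vD[of m] vD[of n]] M[of m] M[of n] by linarith
      then show "dist (v m) (v n) < e" using e by (simp add: power_less_imp_less_base)
    qed
  qed
  then obtain q where q: "v \<longlonglongrightarrow> q" using Cauchy_convergent convergent_def by blast
  have "q \<in> D" using assms(1) vD q closed_sequentially by blast
  moreover have "dist a q = d"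
    using LIMSEQ_unique[OF lim tendsto_dist[OF tendsto_const q]] by simp
  ultimately have min: "is_arg_min (dist a) (\<lambda>v. v \<in> D) q"
    using dle by (simp add: is_arg_min_linorder)
  have uniq: "p = q" if "is_arg_min (dist a) (\<lambda>v. v \<in> D) p" for p
  proof -
    have "p \<in> D" "dist a p = d"
      using that \<open>q \<in> D\<close> \<open>dist a q = d\<close> dle by (fastforce simp: is_arg_min_linorder)+
    then have "(dist p q)\<^sup>2 \<le> 0" using close[of p q] \<open>q \<in> D\<close> \<open>dist a q = d\<close> by simp
    then show ?thesis by simp
  qed
  have "metric_proj D a = q"
    unfolding metric_proj_def arg_min_on_def arg_min_def using min uniq by (rule some_equality)
  then show ?thesis using min uniq by blast
qed

definition cut_C ::
  "'a::real_inner set \<Rightarrow> 'a \<Rightarrow> real \<Rightarrow> 'a \<Rightarrow> 'a \<Rightarrow> 'a set" where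
  "cut_C C x\<^sub>0 a x u =
     {v \<in> C. (norm (u - v))\<^sup>2 \<le> a * (norm (x\<^sub>0 - v))\<^sup>2 + (1 - a) * (norm (x - v))\<^sup>2}"

definition cut_Q :: "'a::real_inner set \<Rightarrow> 'a \<Rightarrow> 'a \<Rightarrow> 'a set" where
  "cut_Q C x\<^sub>0 x = {v \<in> C. inner (x\<^sub>0 - x) (v - x) \<le> 0}"

text \<open>
  \<open>halpern_extragradient C N f M S \<rho> \<alpha> x\<^sub>0 x\<close>: the sequence \<open>x\<close> is generated by the method started
  at \<open>x\<^sub>0\<close>, for some choice of the indices \<open>k n\<close> and \<open>l n\<close> among the maximizers. Since
  \<open>arg_min_on\<close> and \<open>metric_proj\<close> are total, such \<open>x\<close> exist without assuming that the minimizers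
  or projections do.
\<close>

definition halpern_extragradient ::
  "'a::real_inner set \<Rightarrow> nat \<Rightarrow> (nat \<Rightarrow> 'a \<Rightarrow> 'a \<Rightarrow> ereal) \<Rightarrow> nat \<Rightarrow> (nat \<Rightarrow> 'a \<Rightarrow> 'a) \<Rightarrow>
   real \<Rightarrow> (nat \<Rightarrow> real) \<Rightarrow> 'a \<Rightarrow> (nat \<Rightarrow> 'a) \<Rightarrow> bool" where
  "halpern_extragradient C N f M S \<rho> \<alpha> x\<^sub>0 x \<longleftrightarrow>
     x 0 = x\<^sub>0 \<and>
     (\<exists>y z u k l. \<forall>n.
        (\<forall>i\<in>{1..N}. y n i =
           arg_min_on (\<lambda>v. ereal \<rho> * f i (x n) v + ereal (1/2 * (norm (x n - v))\<^sup>2)) C) \<and>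
        (\<forall>i\<in>{1..N}. z n i =
           arg_min_on (\<lambda>v. ereal \<rho> * f i (y n i) v + ereal (1/2 * (norm (x n - v))\<^sup>2)) C) \<and>
        is_arg_max (\<lambda>i. norm (z n i - x n)) (\<lambda>i. i \<in> {1..N}) (k n) \<and>
        (\<forall>j\<in>{1..M}. u n j = \<alpha> n *\<^sub>R x\<^sub>0 + (1 - \<alpha> n) *\<^sub>R S j (z n (k n))) \<and>
        is_arg_max (\<lambda>j. norm (u n j - x n)) (\<lambda>j. j \<in> {1..M}) (l n) \<and>
        x (Suc n) = metric_proj
          (cut_C C x\<^sub>0 (\<alpha> n) (x n) (u n (l n)) \<inter> cut_Q C x\<^sub>0 (x n)) x\<^sub>0)"

end

theory Submission
  imports Defs
begin

text \<open>
  Every iterate satisfies \<open>\<langle>x\<^sub>0 - x\<^sub>n, s - x\<^sub>n\<rangle> \<le> 0\<close> for all \<open>s \<in> F\<close>, because \<open>F\<close> is never cut off. Hence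
  \<open>\<parallel>x\<^sub>n - x\<^sub>0\<parallel>\<close> is bounded and nondecreasing, which makes consecutive iterates, and then all
  auxiliary points, asymptotically equal; weak continuity and demiclosedness place every weak
  cluster point \<open>q\<close> in \<open>F\<close>. The same inequality with \<open>s = q\<close> turns weak into strong convergence,
  and in the limit it says that \<open>q\<close> is the point of \<open>F\<close> nearest to \<open>x\<^sub>0\<close>.
\<close>

section \<open>Proximal points and projections\<close>

text \<open>Norm-bounded sequences have only weak cluster points here, so minimizers are obtained
  from strong convexity and completeness instead: half a squared distance forces almost minimal
  points together. The same existence result serves the two proximal steps and the representation of
  a weak limit functional. The asymptotic estimates run backwards through the method. Membership of
  \<open>x (Suc n)\<close> in \<open>cut_C\<close> is what ties it to \<open>ub n\<close>, and from
  \<open>ub n\<close> one returns to \<open>S j (zb n)\<close>, to \<open>zb n\<close>, and finally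
  to every \<open>y n i\<close>. The delicate passage is from \<open>S j (zb n)\<close> to
  \<open>zb n\<close>, since nearness of images says nothing about nearness of arguments. It goes
  through a point \<open>s\<close> of \<open>F\<close>: as \<open>S j\<close> does not increase the
  distance to \<open>s\<close>, \<open>zb n\<close> cannot be much closer to \<open>s\<close> than
  \<open>x n\<close> is, while the extragradient estimate says that a sizeable step would have
  brought it closer. The maximizing indices transfer the bounds from one index to all.\<close>

lemma proximal_point_exists:
  fixes C :: "'a::{real_inner, complete_space} set"
  assumes C: "closed C" "C \<noteq> {}" and g: "convex_on C g" "continuous_on C g"
    and lower: "\<And>v. v \<in> C \<Longrightarrow> b - B * norm (v - a) \<le> g v"
  obtains p where "p \<in> C" "\<And>v. v \<in> C \<Longrightarrow> g p + (norm (a - p))\<^sup>2 / 2 \<le> g v + (norm (a - v))\<^sup>2 / 2"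
proof -
  define h where "h v = g v + (norm (a - v))\<^sup>2 / 2" for v
  define d where "d = Inf (h ` C)"
  define L where "L n = {v \<in> C. h v \<le> d + 1 / real (Suc n)}" for n
  \<comment> \<open>Completing the square: the quadratic term absorbs the linear loss
    \<open>B * norm (v - a)\<close>, so \<open>h\<close> is bounded below and the infimum
    \<open>d\<close> is meaningful.\<close>
  have h_lower: "b - B\<^sup>2 / 2 \<le> h v" if "v \<in> C" for v
  proof -
    have "0 \<le> (norm (v - a) - B)\<^sup>2 / 2" by simp
    then have "b - B\<^sup>2 / 2 \<le> b - B * norm (v - a) + (norm (v - a))\<^sup>2 / 2"
      by (simp add: power2_eq_square field_simps)
    then show ?thesis using lower[OF that] by (simp add: h_def norm_minus_commute)
  qed
  have bdd: "bdd_below (h ` C)" using h_lower by (auto intro!: bdd_belowI2)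
  have d_le: "d \<le> h v" if "v \<in> C" for v
    unfolding d_def using bdd that by (simp add: cINF_lower)
  \<comment> \<open>Convexity of \<open>g\<close> at the midpoint plus the parallelogram law for the
    squared distances. Hence the diameters of the sublevel sets \<open>L n\<close> shrink to 0 and
    Cantor's nested set theorem yields the minimizer.\<close>
  have close: "(dist u v)\<^sup>2 \<le> 4 * (h u + h v - 2 * d)" if "u \<in> C" "v \<in> C" for u v
  proof -
    have mid: "midpoint u v = (1 - 1/2) *\<^sub>R u + (1/2) *\<^sub>R v"
      by (simp add: midpoint_def scaleR_add_right)
    have "g (midpoint u v) \<le> (1 - 1/2) * g u + (1/2) * g v"
      unfolding mid by (rule convex_onD[OF g(1)]) (use that in auto)
    moreover have "midpoint u v \<in> C"
      unfolding mid using convex_on_imp_convex[OF g(1)] that by (intro convexD_alt) auto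
    then have "d \<le> h (midpoint u v)" by (rule d_le)
    ultimately show ?thesis
      using parallelogram_midpoint[of u v a] by (simp add: h_def dist_norm)
  qed
  have cont: "continuous_on C h" unfolding h_def by (intro continuous_intros g) auto
  have "\<exists>p. \<forall>n. p \<in> L n"
  proof (rule decreasing_closed_nest[of L])
    show "closed (L n)" for n
      unfolding L_def using continuous_closed_preimage[OF cont C(1), of "{..d + 1 / real (Suc n)}"]
      by (simp add: vimage_def Int_def conj_commute)
    show "L n \<noteq> {}" for n
    proof -
      have "\<exists>v\<in>C. h v < d + 1 / real (Suc n)"
        using cINF_less_iff[OF C(2) bdd, of "d + 1 / real (Suc n)"] by (simp add: d_def)
      then show ?thesis by (auto simp: L_def intro: less_imp_le)
    qed
    show "L n \<subseteq> L m" if "m \<le> n" for m n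
    proof -
      have "1 / real (Suc n) \<le> 1 / real (Suc m)" using that by (simp add: field_simps)
      then show ?thesis by (force simp: L_def)
    qed
    show "\<exists>n. \<forall>u\<in>L n. \<forall>v\<in>L n. dist u v < e" if "e > 0" for e
    proof -
      \<comment> \<open>On \<open>L n\<close> the excess \<open>h u + h v - 2 * d\<close> is at most
        \<open>2 / real (Suc n)\<close>; with the factor 4 in \<open>close\<close> this asks for
        \<open>8 / real (Suc n) < e\<^sup>2\<close>.\<close>
      obtain n where n: "1 / real (Suc n) < e\<^sup>2 / 8"
        using reals_Archimedean[of "e\<^sup>2 / 8"] \<open>e > 0\<close> by (auto simp: inverse_eq_divide)
      have "dist u v < e" if "u \<in> L n" "v \<in> L n" for u v
      proof -
        have "(dist u v)\<^sup>2 \<le> 4 * (h u + h v - 2 * d)" using close that by (simp add: L_def)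
        also have "\<dots> < e\<^sup>2" using that n by (simp add: L_def)
        finally show ?thesis using \<open>e > 0\<close> by (simp add: power_less_imp_less_base)
      qed
      then show ?thesis by blast
    qed
  qed blast
  then obtain p where p: "\<And>n. p \<in> L n" by blast
  have "p \<in> C" using p[of 0] by (simp add: L_def)
  moreover have "h p \<le> d"
  proof (rule field_le_epsilon)
    fix e :: real assume "e > 0"
    then obtain n where "1 / real (Suc n) < e"
      using reals_Archimedean[of e] by (auto simp: inverse_eq_divide)
    then show "h p \<le> d + e" using p[of n] by (simp add: L_def)
  qed
  ultimately show ?thesis using that d_le unfolding h_def by (meson order_trans)
qed

lemma norm_diff_sq:
  fixes u v :: "'a::real_inner"
  shows "(norm (u - v))\<^sup>2 = (norm u)\<^sup>2 - 2 * inner u v + (norm v)\<^sup>2"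
  by (simp add: power2_norm_eq_inner inner_diff inner_commute)

text \<open>First-order optimality: compare \<open>p\<close> with the point \<open>q t\<close> of
  the segment towards \<open>v\<close>, divide by \<open>t\<close>, and let \<open>t\<close> tend to
  0 from the right, which removes the quadratic remainder.\<close>

lemma proximal_inequality:
  fixes C :: "'a::real_inner set"
  assumes g: "convex_on C g" and p: "p \<in> C"
    and min: "\<And>v. v \<in> C \<Longrightarrow> g p + (norm (a - p))\<^sup>2 / 2 \<le> g v + (norm (a - v))\<^sup>2 / 2"
    and v: "v \<in> C"
  shows "inner (a - p) (v - p) \<le> g v - g p"
proof -
  define q where "q t = (1 - t) *\<^sub>R p + t *\<^sub>R v" for t :: real
  have bound: "inner (a - p) (v - p) \<le> g v - g p + t * ((norm (v - p))\<^sup>2 / 2)"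
    if t: "0 < t" "t < 1" for t
  proof -
    have "q t \<in> C" unfolding q_def
      using convex_on_imp_convex[OF g] p v t by (intro convexD_alt) auto
    then have "g p + (norm (a - p))\<^sup>2 / 2 \<le> g (q t) + (norm (a - q t))\<^sup>2 / 2" by (rule min)
    moreover have "g (q t) \<le> (1 - t) * g p + t * g v"
      unfolding q_def by (rule convex_onD[OF g]) (use p v t in auto)
    moreover have "a - q t = (a - p) - t *\<^sub>R (v - p)" by (simp add: q_def algebra_simps)
    then have "(norm (a - q t))\<^sup>2
        = (norm (a - p))\<^sup>2 - 2 * t * inner (a - p) (v - p) + t\<^sup>2 * (norm (v - p))\<^sup>2"
      by (simp only: norm_diff_sq inner_scaleR_right norm_scaleR power_mult_distrib power2_abs)
    ultimately have "t * inner (a - p) (v - p)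
        \<le> t * (g v - g p + t * ((norm (v - p))\<^sup>2 / 2))"
      by (simp add: algebra_simps power2_eq_square)
    then show ?thesis using t by simp
  qed
  have "((\<lambda>t. g v - g p + t * ((norm (v - p))\<^sup>2 / 2)) \<longlongrightarrow> g v - g p + 0 * ((norm (v - p))\<^sup>2 / 2))
      (at_right (0::real))"
    by (intro tendsto_intros)
  moreover have "\<forall>\<^sub>F t in at_right (0::real).
      inner (a - p) (v - p) \<le> g v - g p + t * ((norm (v - p))\<^sup>2 / 2)"
    by (rule eventually_at_rightI[of 0 1]) (use bound in auto)
  ultimately show ?thesis
    using tendsto_lowerbound[OF _ _ trivial_limit_at_right_real] by simp
qed

text \<open>A projection is a proximal point of the zero function, so the obtuse angle condition is
  a case of the proximal inequality.\<close>

lemma metric_proj_properties: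
  fixes D :: "'a::{real_inner, complete_space} set"
  assumes "closed D" "convex D" "D \<noteq> {}"
  shows metric_proj_in: "metric_proj D a \<in> D"
    and metric_proj_obtuse: "v \<in> D \<Longrightarrow> inner (a - metric_proj D a) (v - metric_proj D a) \<le> 0"
proof -
  have min: "is_arg_min (dist a) (\<lambda>v. v \<in> D) (metric_proj D a)"
    using is_arg_min_metric_proj_iff[OF assms] by blast
  then show "metric_proj D a \<in> D" by (simp add: is_arg_min_linorder)
  then show "inner (a - metric_proj D a) (v - metric_proj D a) \<le> 0" if "v \<in> D"
    using proximal_inequality[of D "\<lambda>_. 0" "metric_proj D a" a v] min that assms(2)
    by (simp add: is_arg_min_linorder dist_norm convex_on_const)
qed

text \<open>The obtuse angle condition gives a Pythagorean inequality, from which minimality and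
  uniqueness both follow. This recognises a limit as the projection onto \<open>F\<close> from that
  condition and membership alone.\<close>

lemma metric_proj_unique:
  fixes F :: "'a::real_inner set"
  assumes q: "q \<in> F" and obtuse: "\<And>v. v \<in> F \<Longrightarrow> inner (a - q) (v - q) \<le> 0"
  shows "metric_proj F a = q"
proof -
  have le: "(dist a q)\<^sup>2 + (dist q v)\<^sup>2 \<le> (dist a v)\<^sup>2" if "v \<in> F" for v
    using obtuse[OF that]
    by (simp add: dist_norm power2_norm_eq_inner inner_diff inner_commute algebra_simps)
  have min: "dist a q \<le> dist a v" if "v \<in> F" for v
  proof (rule power2_le_imp_le)
    show "(dist a q)\<^sup>2 \<le> (dist a v)\<^sup>2"
      using le[OF that] zero_le_power2[of "dist q v"] by linarith
  qed simp
  then have "is_arg_min (dist a) (\<lambda>v. v \<in> F) q" using q by (simp add: is_arg_min_linorder)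
  moreover have "p = q" if "is_arg_min (dist a) (\<lambda>v. v \<in> F) p" for p
  proof -
    have "p \<in> F" "dist a p \<le> dist a q" using that q by (auto simp: is_arg_min_linorder)
    moreover from this have "(dist a p)\<^sup>2 \<le> (dist a q)\<^sup>2" by (intro power_mono) auto
    ultimately have "(dist q p)\<^sup>2 \<le> 0" using le[of p] by linarith
    then show ?thesis by simp
  qed
  ultimately show ?thesis
    unfolding metric_proj_def arg_min_on_def arg_min_def by (rule some_equality)
qed

section \<open>Weak convergence\<close>

lemma weakly_tendstoD: "weakly_tendsto X q \<Longrightarrow> (\<lambda>n. inner (X n) h) \<longlonglongrightarrow> inner q h"
  by (simp add: weakly_tendsto_def)

lemma tendsto_imp_weakly_tendsto: "X \<longlonglongrightarrow> q \<Longrightarrow> weakly_tendsto X q"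
  unfolding weakly_tendsto_def by (intro allI tendsto_inner tendsto_const)

lemma weakly_tendsto_perturb:
  assumes "weakly_tendsto X q" "(\<lambda>n. X n - Y n) \<longlonglongrightarrow> 0"
  shows "weakly_tendsto Y q"
  unfolding weakly_tendsto_def
proof
  fix h
  have "(\<lambda>n. inner (X n) h - inner (X n - Y n) h) \<longlonglongrightarrow> inner q h - inner 0 h"
    by (intro tendsto_diff weakly_tendstoD[OF assms(1)] tendsto_inner assms(2) tendsto_const)
  then show "(\<lambda>n. inner (Y n) h) \<longlonglongrightarrow> inner q h" by (simp add: inner_diff_left)
qed

text \<open>Test the weak convergence with \<open>q - p\<close>, where \<open>p\<close> is the
  projection of \<open>q\<close>: the obtuse angle inequality at the points \<open>X n\<close>
  becomes \<open>inner (q - p) (q - p) \<le> 0\<close> in the limit.\<close>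

lemma closed_convex_weak_limit:
  fixes C :: "'a::{real_inner, complete_space} set"
  assumes C: "closed C" "convex C" and X: "range X \<subseteq> C" "weakly_tendsto X q"
  shows "q \<in> C"
proof -
  have ne: "C \<noteq> {}" using X(1) by auto
  define p where "p = metric_proj C q"
  have "(\<lambda>n. inner (X n) (q - p) - inner p (q - p)) \<longlonglongrightarrow> inner q (q - p) - inner p (q - p)"
    by (intro tendsto_diff weakly_tendstoD[OF X(2)] tendsto_const)
  moreover have "inner (X n) (q - p) - inner p (q - p) \<le> 0" for n
    using metric_proj_obtuse[OF C ne, of "X n" q] X(1)
    by (auto simp: p_def inner_diff inner_commute algebra_simps)
  ultimately have "inner q (q - p) - inner p (q - p) \<le> 0"
    by (intro LIMSEQ_le_const2) auto
  then have "inner (q - p) (q - p) \<le> 0" by (simp add: inner_diff_left)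
  then have "q = p" using inner_ge_zero[of "q - p"] by (simp add: order_antisym_conv)
  then show ?thesis using metric_proj_in[OF C ne, of q] by (simp add: p_def)
qed

text \<open>Tychonoff in place of a hand-made diagonal sequence: a product of intervals is compact,
  and countability of the index type makes the product metrizable, hence sequentially
  compact.\<close>

lemma subseq_coordinatewise_convergent:
  fixes g :: "nat \<Rightarrow> 'i::countable \<Rightarrow> real"
  assumes "\<And>n i. \<bar>g n i\<bar> \<le> B i"
  obtains r where "strict_mono (r :: nat \<Rightarrow> nat)" "\<And>i. convergent (\<lambda>n. g (r n) i)"
proof -
  have "compact (PiE UNIV (\<lambda>i. {- B i..B i}))"
    unfolding compactin_euclidean_iff[symmetric] euclidean_product_topology[symmetric]
    by (simp add: compactin_PiE)
  moreover have "- B i \<le> g n i" "g n i \<le> B i" for n i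
    using assms[of n i] by linarith+
  then have "\<forall>n. g n \<in> PiE UNIV (\<lambda>i. {- B i..B i})" by auto
  ultimately obtain l r where "strict_mono (r :: nat \<Rightarrow> nat)" and l: "(g \<circ> r) \<longlonglongrightarrow> l"
    unfolding compact_eq_seq_compact_metric by (rule seq_compactE)
  moreover have "(\<lambda>n. g (r n) i) \<longlonglongrightarrow> l i" for i
    using continuous_on_tendsto_compose[OF continuous_on_product_coordinates l] by (simp add: o_def)
  ultimately show ?thesis using that by (auto simp: convergent_def)
qed

text \<open>Diagonalising only against the sequence itself suffices: the \<open>h\<close> for which the inner products
  with the subsequence converge form a closed subspace \<open>L\<close> that contains the sequence, so the
  orthogonal complement of \<open>L\<close> contributes nothing. The limit functional is represented on \<open>L\<close> by
  the minimizer of \<open>\<parallel>h\<parallel>\<^sup>2 / 2\<close> minus the functional.\<close>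

lemma bounded_weakly_convergent_subseq:
  fixes X :: "nat \<Rightarrow> 'a::{real_inner, complete_space}"
  assumes "bounded (range X)"
  obtains r q where "strict_mono (r :: nat \<Rightarrow> nat)" "weakly_tendsto (X \<circ> r) q"
proof -
  obtain B where "B > 0" and B: "\<And>n. norm (X n) \<le> B"
    using assms unfolding bounded_pos by auto
  have CS: "\<bar>inner (X n) h\<bar> \<le> B * norm h" for n h
    using Cauchy_Schwarz_ineq2[of "X n" h] B[of n] mult_right_mono[of "norm (X n)" B "norm h"] by simp
  obtain r where r: "strict_mono (r :: nat \<Rightarrow> nat)"
    and conv: "\<And>m. convergent (\<lambda>n. inner (X (r n)) (X m))"
    using subseq_coordinatewise_convergent[of "\<lambda>n m. inner (X n) (X m)" "\<lambda>m. B * norm (X m)"] CS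
    by blast
  define L where "L = {h. convergent (\<lambda>n. inner (X (r n)) h)}"
  define l where "l h = lim (\<lambda>n. inner (X (r n)) h)" for h
  have lim: "(\<lambda>n. inner (X (r n)) h) \<longlonglongrightarrow> l h" if "h \<in> L" for h
    using that by (simp add: L_def l_def convergent_LIMSEQ_iff)
  have L_add: "a *\<^sub>R h + b *\<^sub>R k \<in> L" "l (a *\<^sub>R h + b *\<^sub>R k) = a * l h + b * l k"
    if "h \<in> L" "k \<in> L" for a b h k
  proof -
    have "(\<lambda>n. inner (X (r n)) (a *\<^sub>R h + b *\<^sub>R k)) \<longlonglongrightarrow> a * l h + b * l k"
      unfolding inner_add_right inner_scaleR_right using that by (intro tendsto_intros lim)
    then show "a *\<^sub>R h + b *\<^sub>R k \<in> L" "l (a *\<^sub>R h + b *\<^sub>R k) = a * l h + b * l k"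
      by (auto simp: L_def l_def convergent_def limI)
  qed
  have XL: "X m \<in> L" for m using conv by (simp add: L_def)
  have L0: "0 \<in> L" by (simp add: L_def convergent_const)
  have l0: "l 0 = 0" by (simp add: l_def)
  have l_le: "\<bar>l h\<bar> \<le> B * norm h" if "h \<in> L" for h
    using LIMSEQ_le_const2[OF tendsto_rabs[OF lim[OF that]]] CS by blast
  have "closed L"
  proof (subst closed_sequential_limits, intro allI impI, elim conjE)
    fix h k assume h: "\<forall>n. h n \<in> L" "h \<longlonglongrightarrow> k"
    have "Cauchy (\<lambda>n. inner (X (r n)) k)"
    proof (rule metric_CauchyI)
      fix e :: real assume "e > 0"
      then obtain j where "dist (h j) k < e / (4 * B)"
        using metric_LIMSEQ_D[OF h(2), of "e / (4 * B)"] \<open>B > 0\<close> by auto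
      then have j: "B * norm (k - h j) < e / 4"
        using \<open>B > 0\<close> by (simp add: dist_norm norm_minus_commute field_simps)
      have "Cauchy (\<lambda>n. inner (X (r n)) (h j))"
        using h(1) by (simp add: L_def Cauchy_convergent_iff)
      then obtain N where N: "\<And>m n. m \<ge> N \<Longrightarrow> n \<ge> N \<Longrightarrow>
          dist (inner (X (r m)) (h j)) (inner (X (r n)) (h j)) < e / 2"
        using metric_CauchyD[of _ "e / 2"] \<open>e > 0\<close> by (metis half_gt_zero)
      have "dist (inner (X (r m)) k) (inner (X (r n)) k) < e" if "m \<ge> N" "n \<ge> N" for m n
        using N[OF that] CS[of "r m" "k - h j"] CS[of "r n" "k - h j"] j
        unfolding dist_real_def inner_diff_right by linarith
      then show "\<exists>N. \<forall>m\<ge>N. \<forall>n\<ge>N. dist (inner (X (r m)) k) (inner (X (r n)) k) < e" by blast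
    qed
    then show "k \<in> L" by (simp add: L_def Cauchy_convergent_iff)
  qed
  have "convex L" unfolding convex_def using L_add(1) by blast
  have "convex_on L (\<lambda>h. - l h)"
    by (intro convex_onI \<open>convex L\<close>) (simp add: L_add(2))
  moreover have "continuous_on L (\<lambda>h. - l h)"
  proof (intro continuous_on_minus, rule lipschitz_on_continuous_on, rule lipschitz_onI)
    show "dist (l h) (l k) \<le> B * dist h k" if "h \<in> L" "k \<in> L" for h k
      using l_le[OF L_add(1)[OF that, of 1 "- 1"]] L_add(2)[OF that, of 1 "- 1"]
      by (simp add: dist_norm)
  qed (use \<open>B > 0\<close> in simp)
  moreover have "0 - B * norm (h - 0) \<le> - l h" if "h \<in> L" for h using l_le[OF that] by simp
  ultimately obtain q where q: "q \<in> L" and min: "\<And>h. h \<in> L \<Longrightarrow>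
      - l q + (norm (0 - q))\<^sup>2 / 2 \<le> - l h + (norm (0 - h))\<^sup>2 / 2"
    using proximal_point_exists[OF \<open>closed L\<close>, of "\<lambda>h. - l h" 0 B 0] L0 by blast
  \<comment> \<open>\<open>L\<close> is a subspace, so the variational inequality holds at both
    \<open>q + h\<close> and \<open>q - h\<close>; the two bounds are opposite and force equality.
    The same device gives \<open>orth\<close> below.\<close>
  have rep: "l h = inner q h" if "h \<in> L" for h
  proof -
    have "inner (0 - q) (k - q) \<le> - l k - - l q" if "k \<in> L" for k
      by (rule proximal_inequality[OF \<open>convex_on L (\<lambda>h. - l h)\<close> q min that])
    from this[OF L_add(1)[OF q that, of 1 1]] this[OF L_add(1)[OF q that, of 1 "- 1"]]
    show ?thesis
      using L_add(2)[OF q that, of 1 1] L_add(2)[OF q that, of 1 "- 1"] by simp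
  qed
  have "(\<lambda>n. inner (X (r n)) h) \<longlonglongrightarrow> inner q h" for h
  proof -
    define p where "p = metric_proj L h"
    have ne: "L \<noteq> {}" using L0 by blast
    have p: "p \<in> L"
      unfolding p_def by (rule metric_proj_in[OF \<open>closed L\<close> \<open>convex L\<close> ne])
    have orth: "inner k h = inner k p" if "k \<in> L" for k
      using metric_proj_obtuse[OF \<open>closed L\<close> \<open>convex L\<close> ne L_add(1)[OF p that, of 1 1], of h]
        metric_proj_obtuse[OF \<open>closed L\<close> \<open>convex L\<close> ne L_add(1)[OF p that, of 1 "- 1"], of h]
      by (simp add: p_def[symmetric] inner_diff_left inner_diff_right inner_commute)
    show ?thesis using lim[OF p] rep[OF p] orth[OF XL] orth[OF q] by simp
  qed
  then show ?thesis using that[OF r, of q] by (simp add: weakly_tendsto_def)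
qed

text \<open>Expanding \<open>(norm (X n - S q))\<^sup>2\<close> around \<open>q\<close> and bounding
  it through \<open>S (X n)\<close> both produce \<open>(norm (X n - q))\<^sup>2\<close>, whose
  limit is unknown. It cancels, and everything left besides \<open>(norm (q - S q))\<^sup>2\<close>
  tends to 0.\<close>

lemma nonexpansive_demiclosed:
  fixes S :: "'a::real_inner \<Rightarrow> 'a"
  assumes S: "nonexpansive_on C S" and X: "range X \<subseteq> C" "bounded (range X)"
    and q: "weakly_tendsto X q" "q \<in> C" and asym: "(\<lambda>n. X n - S (X n)) \<longlonglongrightarrow> 0"
  shows "S q = q"
proof -
  obtain B where B: "\<And>n. norm (X n - q) \<le> B"
    using bounded_plus_comp[OF X(2), of "\<lambda>_. 0"] X(2) unfolding bounded_iff
    by (metis add_right_mono norm_triangle_ineq4 order_trans rangeI)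
  define e where "e n = norm (X n - S (X n))" for n
  have e: "e \<longlonglongrightarrow> 0" unfolding e_def using asym by (rule tendsto_norm_zero)
  have "(norm (q - S q))\<^sup>2 \<le> (e n)\<^sup>2 + 2 * e n * B - 2 * (inner (X n) (q - S q) - inner q (q - S q))"
    for n
  proof -
    have "norm (S (X n) - S q) \<le> norm (X n - q)"
      using S X(1) q(2) by (auto simp: nonexpansive_on_def)
    then have "norm (X n - S q) \<le> e n + norm (X n - q)"
      using norm_triangle_ineq[of "X n - S (X n)" "S (X n) - S q"] by (simp add: e_def)
    then have "(norm (X n - S q))\<^sup>2 \<le> (e n + norm (X n - q))\<^sup>2" by (rule power_mono) simp
    moreover have "e n * norm (X n - q) \<le> e n * B"
      using B by (intro mult_left_mono) (auto simp: e_def)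
    moreover have "(norm (X n - S q))\<^sup>2 = (norm (X n - q))\<^sup>2
        + 2 * (inner (X n) (q - S q) - inner q (q - S q)) + (norm (q - S q))\<^sup>2"
      by (simp add: power2_norm_eq_inner inner_diff inner_commute algebra_simps)
    ultimately show ?thesis by (simp add: power2_sum)
  qed
  moreover have "(\<lambda>n. (e n)\<^sup>2 + 2 * e n * B - 2 * (inner (X n) (q - S q) - inner q (q - S q)))
      \<longlonglongrightarrow> 0\<^sup>2 + 2 * 0 * B - 2 * (inner q (q - S q) - inner q (q - S q))"
    by (intro tendsto_diff tendsto_add tendsto_mult tendsto_power weakly_tendstoD[OF q(1)]
        tendsto_const e)
  ultimately have "(norm (q - S q))\<^sup>2
      \<le> 0\<^sup>2 + 2 * 0 * B - 2 * (inner q (q - S q) - inner q (q - S q))"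
    by (intro LIMSEQ_le_const) auto
  then show ?thesis by simp
qed

lemma converges_if_subseqs_converge:
  fixes X :: "nat \<Rightarrow> 'a::metric_space"
  assumes "\<And>r. strict_mono (r :: nat \<Rightarrow> nat) \<Longrightarrow> \<exists>s. strict_mono (s :: nat \<Rightarrow> nat) \<and> (X \<circ> r \<circ> s) \<longlonglongrightarrow> p"
  shows "X \<longlonglongrightarrow> p"
proof (rule ccontr)
  assume "\<not> X \<longlonglongrightarrow> p"
  then obtain e where "e > 0" and e: "\<not> (\<forall>\<^sub>F n in sequentially. dist (X n) p < e)"
    by (auto simp: tendsto_iff)
  then have "infinite {n. \<not> dist (X n) p < e}"
    by (simp add: INFM_iff_infinite[symmetric] frequently_def cofinite_eq_sequentially)
  then obtain r :: "nat \<Rightarrow> nat" where r: "strict_mono r" "\<And>n. \<not> dist (X (r n)) p < e"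
    using infinite_enumerate by blast
  obtain s where "(X \<circ> r \<circ> s) \<longlonglongrightarrow> p" using assms[OF r(1)] by blast
  then show False using metric_LIMSEQ_D[OF _ \<open>e > 0\<close>] r(2) by fastforce
qed

text \<open>The obtuse angle condition gives
  \<open>\<parallel>X n - q\<parallel>\<^sup>2 \<le> \<langle>a - q, X n - q\<rangle>\<close> for \<open>q \<in> F\<close>, which upgrades weak to strong convergence.\<close>

lemma tendsto_metric_proj_if_weak_cluster_points:
  fixes X :: "nat \<Rightarrow> 'a::{real_inner, complete_space}"
  assumes bdd: "bounded (range X)"
    and obtuse: "\<And>n v. v \<in> F \<Longrightarrow> inner (a - X n) (v - X n) \<le> 0"
    and cluster: "\<And>r q. strict_mono (r :: nat \<Rightarrow> nat) \<Longrightarrow> weakly_tendsto (X \<circ> r) q \<Longrightarrow> q \<in> F"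
  shows "X \<longlonglongrightarrow> metric_proj F a"
proof (rule converges_if_subseqs_converge)
  fix r :: "nat \<Rightarrow> nat" assume r: "strict_mono r"
  have "bounded (range (X \<circ> r))" using bdd by (rule bounded_subset) auto
  then obtain s q where s: "strict_mono (s :: nat \<Rightarrow> nat)" and q: "weakly_tendsto (X \<circ> r \<circ> s) q"
    using bounded_weakly_convergent_subseq by blast
  define Y where "Y = X \<circ> r \<circ> s"
  have "q \<in> F" using cluster[of "r \<circ> s" q] q strict_mono_o[OF r s] by (simp add: o_assoc)
  have obtY: "inner (a - Y n) (v - Y n) \<le> 0" if "v \<in> F" for n v
    using obtuse[OF that] by (simp add: Y_def)
  have le: "(norm (Y n - q))\<^sup>2 \<le> inner (Y n) (a - q) - inner q (a - q)" for n
    using obtY[OF \<open>q \<in> F\<close>, of n]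
    by (simp add: power2_norm_eq_inner inner_diff inner_commute algebra_simps)
  have lim: "(\<lambda>n. inner (Y n) (a - q) - inner q (a - q)) \<longlonglongrightarrow> inner q (a - q) - inner q (a - q)"
    using q by (intro tendsto_diff weakly_tendstoD[of Y] tendsto_const) (simp add: Y_def)
  have "(\<lambda>n. (norm (Y n - q))\<^sup>2) \<longlonglongrightarrow> 0"
    by (rule tendsto_sandwich[OF _ _ tendsto_const[of 0]]) (use le lim in auto)
  from tendsto_real_sqrt[OF this] have "(\<lambda>n. norm (Y n - q)) \<longlonglongrightarrow> 0" by simp
  then have Yq: "Y \<longlonglongrightarrow> q" by (simp add: tendsto_norm_zero_iff LIM_zero_iff)
  have "inner (a - q) (v - q) \<le> 0" if "v \<in> F" for v
  proof (rule LIMSEQ_le_const2)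
    show "(\<lambda>n. inner (a - Y n) (v - Y n)) \<longlonglongrightarrow> inner (a - q) (v - q)"
      by (intro tendsto_intros Yq)
  qed (use obtY[OF that] in blast)
  then have "metric_proj F a = q" using metric_proj_unique[OF \<open>q \<in> F\<close>] by blast
  then show "\<exists>s. strict_mono (s :: nat \<Rightarrow> nat) \<and> (X \<circ> r \<circ> s) \<longlonglongrightarrow> metric_proj F a"
    using s Yq by (intro exI[of _ s]) (simp add: Y_def)
qed

section \<open>Equilibrium bifunctions\<close>

locale equilibrium_bifunction =
  fixes C :: "'a::{real_inner, complete_space} set" and f :: "'a \<Rightarrow> 'a \<Rightarrow> ereal"
    and c\<^sub>1 c\<^sub>2 :: real
  assumes closed: "closed C"
    and bifunction: "bifunction_on C f"
    and pseudomonotone: "pseudomonotone_on C f"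
    and lipschitz_type: "lipschitz_type_on c\<^sub>1 c\<^sub>2 C f"
    and weakly_continuous: "weakly_continuous_on C f"
    and convex: "\<And>v. v \<in> C \<Longrightarrow> ereal_convex_on C (f v)"
    and subdifferentiable: "\<And>v. v \<in> C \<Longrightarrow> subdifferentiable_on C (f v)"
begin

definition \<phi> :: "'a \<Rightarrow> 'a \<Rightarrow> real" where
  "\<phi> u v = real_of_ereal (f u v)"

text \<open>A subgradient at \<open>v\<close> bounds \<open>f u v\<close> by \<open>f u u = 0\<close> up to a finite amount, so the value
  \<open>+\<infinity>\<close> is not attained on \<open>C \<times> C\<close>.\<close>

lemma f_eq_\<phi>:
  assumes "u \<in> C" "v \<in> C"
  shows "f u v = ereal (\<phi> u v)"
proof -
  obtain w where "\<forall>z\<in>C. f u v + ereal (inner w (z - v)) \<le> f u z"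
    using subdifferentiable[OF assms(1)] assms(2)
    unfolding subdifferentiable_on_def subdifferential_on_def by blast
  then have "f u v + ereal (inner w (u - v)) \<le> 0"
    using assms(1) bifunction unfolding bifunction_on_def by metis
  moreover have "f u v \<noteq> -\<infinity>" using assms bifunction by (simp add: bifunction_on_def)
  ultimately show ?thesis unfolding \<phi>_def by (cases "f u v") auto
qed

lemma \<phi>_refl: "u \<in> C \<Longrightarrow> \<phi> u u = 0"
  using bifunction by (simp add: bifunction_on_def \<phi>_def)

lemma \<phi>_lipschitz_type:
  assumes "u \<in> C" "v \<in> C" "w \<in> C"
  shows "\<phi> u w \<le> \<phi> u v + \<phi> v w + c\<^sub>1 * (norm (u - v))\<^sup>2 + c\<^sub>2 * (norm (v - w))\<^sup>2"
proof -
  have "f u w - ereal (c\<^sub>1 * (norm (u - v))\<^sup>2) - ereal (c\<^sub>2 * (norm (v - w))\<^sup>2) \<le> f u v + f v w"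
    using lipschitz_type assms unfolding lipschitz_type_on_def by blast
  then show ?thesis using assms by (simp add: f_eq_\<phi>)
qed

lemma \<phi>_convex: "u \<in> C \<Longrightarrow> convex_on C (\<phi> u)"
proof (rule convex_onI)
  assume u: "u \<in> C"
  then show cvx: "convex C" using convex by (simp add: ereal_convex_on_def)
  fix t :: real and v w assume t: "0 < t" "t < 1" and vw: "v \<in> C" "w \<in> C"
  have "(1 - t) *\<^sub>R v + t *\<^sub>R w \<in> C" using cvx vw t by (intro convexD_alt) auto
  moreover have "f u ((1 - t) *\<^sub>R v + t *\<^sub>R w) \<le> ereal (1 - t) * f u v + ereal t * f u w"
    using convex[OF u] vw t unfolding ereal_convex_on_def by auto
  ultimately show "\<phi> u ((1 - t) *\<^sub>R v + t *\<^sub>R w) \<le> (1 - t) * \<phi> u v + t * \<phi> u w"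
    using u vw by (simp add: f_eq_\<phi>)
qed

lemma \<phi>_tendsto:
  assumes "range X \<subseteq> C" "range Y \<subseteq> C" "u \<in> C" "v \<in> C" "weakly_tendsto X u" "weakly_tendsto Y v"
  shows "(\<lambda>n. \<phi> (X n) (Y n)) \<longlonglongrightarrow> \<phi> u v"
proof -
  have "(\<lambda>n. f (X n) (Y n)) \<longlonglongrightarrow> ereal (\<phi> u v)"
    using weakly_continuous assms unfolding weakly_continuous_on_def
    by (metis f_eq_\<phi>)
  then show ?thesis unfolding \<phi>_def[of "X _"] by (rule lim_real_of_ereal)
qed

lemma \<phi>_continuous:
  assumes "u \<in> C"
  shows "continuous_on C (\<phi> u)"
  unfolding continuous_on_sequentially comp_def
proof (intro allI ballI impI)
  fix Y v assume "v \<in> C" and "(\<forall>n. Y n \<in> C) \<and> Y \<longlonglongrightarrow> v"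
  then show "(\<lambda>n. \<phi> u (Y n)) \<longlonglongrightarrow> \<phi> u v"
    using assms \<phi>_tendsto[of "\<lambda>_. u" Y u v] tendsto_imp_weakly_tendsto by blast
qed

text \<open>A subgradient at \<open>a\<close> gives an affine minorant; Cauchy-Schwarz turns it into
  the growth bound that \<open>proximal_point_exists\<close> requires.\<close>

lemma \<phi>_lower_bound:
  assumes "u \<in> C" "a \<in> C"
  obtains b B where "\<And>v. v \<in> C \<Longrightarrow> b - B * norm (v - a) \<le> \<phi> u v"
proof -
  obtain w where w: "\<forall>z\<in>C. f u a + ereal (inner w (z - a)) \<le> f u z"
    using subdifferentiable[OF assms(1)] assms(2)
    unfolding subdifferentiable_on_def subdifferential_on_def by blast
  have "\<phi> u a - norm w * norm (v - a) \<le> \<phi> u v" if "v \<in> C" for v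
    using bspec[OF w that] Cauchy_Schwarz_ineq2[of w "v - a"] assms that by (simp add: f_eq_\<phi>)
  then show ?thesis by (rule that)
qed

definition prox :: "real \<Rightarrow> 'a \<Rightarrow> 'a \<Rightarrow> 'a" where
  "prox \<rho> u a = arg_min_on (\<lambda>v. ereal \<rho> * f u v + ereal (1/2 * (norm (a - v))\<^sup>2)) C"

lemma prox_properties:
  assumes u: "u \<in> C" and a: "a \<in> C" and \<rho>: "0 < \<rho>"
  shows prox_in: "prox \<rho> u a \<in> C"
    and prox_inequality: "v \<in> C \<Longrightarrow>
      inner (a - prox \<rho> u a) (v - prox \<rho> u a) \<le> \<rho> * (\<phi> u v - \<phi> u (prox \<rho> u a))"
proof -
  let ?h = "\<lambda>v. ereal \<rho> * f u v + ereal (1/2 * (norm (a - v))\<^sup>2)"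
  have h: "?h v = ereal (\<rho> * \<phi> u v + (norm (a - v))\<^sup>2 / 2)" if "v \<in> C" for v
    using f_eq_\<phi>[OF u that] by simp
  obtain b B where "\<And>v. v \<in> C \<Longrightarrow> b - B * norm (v - a) \<le> \<phi> u v"
    using \<phi>_lower_bound[OF u a] by blast
  then have lower: "\<rho> * b - (\<rho> * B) * norm (v - a) \<le> \<rho> * \<phi> u v" if "v \<in> C" for v
    using mult_left_mono[of "b - B * norm (v - a)" "\<phi> u v" \<rho>] that \<rho> by (simp add: algebra_simps)
  have cvx: "convex_on C (\<lambda>v. \<rho> * \<phi> u v)" using \<phi>_convex[OF u] \<rho> by (intro convex_on_cmul) auto
  have "continuous_on C (\<lambda>v. \<rho> * \<phi> u v)"
    by (intro continuous_on_mult continuous_on_const \<phi>_continuous u)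
  then obtain p where p: "p \<in> C"
    and min: "\<And>v. v \<in> C \<Longrightarrow> \<rho> * \<phi> u p + (norm (a - p))\<^sup>2 / 2 \<le> \<rho> * \<phi> u v + (norm (a - v))\<^sup>2 / 2"
    using proximal_point_exists[OF closed _ cvx _ lower] a by blast
  \<comment> \<open>\<open>arg_min_on\<close> is a Hilbert choice, so exhibiting one minimizer
    \<open>p\<close> is what makes \<open>prox\<close> a minimizer too.\<close>
  have "is_arg_min ?h (\<lambda>v. v \<in> C) p"
    unfolding is_arg_min_linorder using p min h by simp
  then have "is_arg_min ?h (\<lambda>v. v \<in> C) (prox \<rho> u a)"
    unfolding prox_def arg_min_on_def arg_min_def by (rule someI)
  then have q: "prox \<rho> u a \<in> C"
    and qmin: "\<And>v. v \<in> C \<Longrightarrow> ?h (prox \<rho> u a) \<le> ?h v"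
    unfolding is_arg_min_linorder by blast+
  show "prox \<rho> u a \<in> C" by (rule q)
  show "inner (a - prox \<rho> u a) (v - prox \<rho> u a) \<le> \<rho> * (\<phi> u v - \<phi> u (prox \<rho> u a))" if "v \<in> C"
    using proximal_inequality[OF cvx q _ that, of a] qmin h q by (simp add: right_diff_distrib)
qed

lemma equilibriumD:
  assumes "s \<in> equilibria C f"
  shows "s \<in> C" "v \<in> C \<Longrightarrow> \<phi> v s \<le> 0"
proof -
  show "s \<in> C" using assms by (simp add: equilibria_def)
  then show "\<phi> v s \<le> 0" if "v \<in> C"
    using assms pseudomonotone that unfolding equilibria_def pseudomonotone_on_def
    by (simp add: f_eq_\<phi>)
qed

text \<open>Add the proximal inequality of \<open>z\<close> tested with \<open>s\<close> to that of
  \<open>y\<close> tested with \<open>z\<close>. Pseudomonotonicity gives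
  \<open>\<phi> y s \<le> 0\<close>, and the remaining values of \<phi> form exactly the combination
  that the Lipschitz-type condition bounds by squared distances.\<close>

lemma extragradient_estimate:
  assumes a: "a \<in> C" and s: "s \<in> equilibria C f" and \<rho>: "0 < \<rho>"
  defines "y \<equiv> prox \<rho> a a"
  defines "z \<equiv> prox \<rho> y a"
  shows "(1 - 2 * \<rho> * c\<^sub>1) * (norm (a - y))\<^sup>2 + (1 - 2 * \<rho> * c\<^sub>2) * (norm (y - z))\<^sup>2
    \<le> (norm (a - s))\<^sup>2 - (norm (z - s))\<^sup>2"
proof -
  have y: "y \<in> C" unfolding y_def using a \<rho> by (intro prox_in)
  have z: "z \<in> C" unfolding z_def using a y \<rho> by (intro prox_in)
  have "inner (a - z) (s - z) \<le> \<rho> * (\<phi> y s - \<phi> y z)"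
    unfolding z_def using y a \<rho> equilibriumD(1)[OF s] by (rule prox_inequality)
  moreover have "inner (a - y) (z - y) \<le> \<rho> * (\<phi> a z - \<phi> a y)"
    unfolding y_def using a a \<rho> z unfolding y_def by (rule prox_inequality)
  moreover have "\<rho> * (\<phi> y s - \<phi> y z + \<phi> a z - \<phi> a y)
      \<le> \<rho> * (c\<^sub>1 * (norm (a - y))\<^sup>2 + c\<^sub>2 * (norm (y - z))\<^sup>2)"
    using \<phi>_lipschitz_type[OF a y z] equilibriumD(2)[OF s y] \<rho> by (intro mult_left_mono) auto
  ultimately have "2 * inner (a - z) (s - z) + 2 * inner (a - y) (z - y)
      \<le> 2 * \<rho> * c\<^sub>1 * (norm (a - y))\<^sup>2 + 2 * \<rho> * c\<^sub>2 * (norm (y - z))\<^sup>2"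
    by (simp add: algebra_simps)
  \<comment> \<open>Polarise each product; the two occurrences of
    \<open>(norm (a - z))\<^sup>2\<close> cancel.\<close>
  moreover have "2 * inner (a - z) (s - z) + 2 * inner (a - y) (z - y)
      = (norm (z - s))\<^sup>2 - (norm (a - s))\<^sup>2 + (norm (a - y))\<^sup>2 + (norm (y - z))\<^sup>2"
    by (simp add: power2_norm_eq_inner inner_diff inner_commute)
  ultimately show ?thesis by (simp add: algebra_simps)
qed

text \<open>In the proximal inequality for \<open>y n\<close> tested with \<open>v\<close>, the
  inner product is at least a null sequence, because \<open>X n - y n\<close> vanishes and
  \<open>v - y n\<close> stays bounded. On the other side both arguments of \<phi> move, and joint
  weak continuity yields \<open>\<rho> * (\<phi> q v - \<phi> q q)\<close>, where the last value is
  0.\<close>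

lemma weak_limit_equilibrium:
  assumes X: "range X \<subseteq> C" "bounded (range X)" "weakly_tendsto X q" and \<rho>: "0 < \<rho>"
    and asym: "(\<lambda>n. X n - prox \<rho> (X n) (X n)) \<longlonglongrightarrow> 0"
  shows "q \<in> equilibria C f"
proof -
  define y where "y n = prox \<rho> (X n) (X n)" for n
  define e where "e n = norm (X n - y n)" for n
  have e: "e \<longlonglongrightarrow> 0" unfolding e_def y_def using asym by (rule tendsto_norm_zero)
  have XC: "X n \<in> C" for n using X(1) by auto
  have yC: "y n \<in> C" for n unfolding y_def by (intro prox_in XC \<rho>)
  have "convex C" using convex[OF XC] by (simp add: ereal_convex_on_def)
  then have q: "q \<in> C" using closed_convex_weak_limit[OF closed _ X(1,3)] by blast
  have yq: "weakly_tendsto y q"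
    using weakly_tendsto_perturb[OF X(3), of y] asym by (simp add: y_def)
  obtain B where B: "\<And>n. norm (X n) \<le> B" using X(2) by (auto simp: bounded_iff)
  have "0 \<le> \<phi> q v" if v: "v \<in> C" for v
  proof -
    have "- (e n * (norm v + B + e n)) \<le> \<rho> * (\<phi> (X n) v - \<phi> (X n) (y n))" for n
    proof -
      have "norm (v - y n) \<le> norm v + B + e n"
        using norm_triangle_ineq[of "v - X n" "X n - y n"] norm_triangle_ineq4[of v "X n"] B[of n]
        by (simp add: e_def)
      then have "e n * norm (v - y n) \<le> e n * (norm v + B + e n)"
        by (intro mult_left_mono) (auto simp: e_def)
      then have "- (e n * (norm v + B + e n)) \<le> inner (X n - y n) (v - y n)"
        using Cauchy_Schwarz_ineq2[of "X n - y n" "v - y n"] by (simp add: e_def)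
      also have "\<dots> \<le> \<rho> * (\<phi> (X n) v - \<phi> (X n) (y n))"
        unfolding y_def by (intro prox_inequality XC \<rho> v)
      finally show ?thesis .
    qed
    moreover have "(\<lambda>n. - (e n * (norm v + B + e n))) \<longlonglongrightarrow> - (0 * (norm v + B + 0))"
      by (intro tendsto_intros e)
    moreover have "(\<lambda>n. \<rho> * (\<phi> (X n) v - \<phi> (X n) (y n))) \<longlonglongrightarrow> \<rho> * (\<phi> q v - \<phi> q q)"
    proof (intro tendsto_mult tendsto_diff tendsto_const \<phi>_tendsto)
      show "weakly_tendsto (\<lambda>_. v) v" by (intro tendsto_imp_weakly_tendsto tendsto_const)
    qed (use X q v yC yq in auto)
    ultimately have "- (0 * (norm v + B + 0)) \<le> \<rho> * (\<phi> q v - \<phi> q q)"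
      by (intro LIMSEQ_le) auto
    then show ?thesis using \<rho> \<phi>_refl[OF q] by (simp add: zero_le_mult_iff)
  qed
  then show ?thesis using q by (simp add: equilibria_def f_eq_\<phi>)
qed

end

section \<open>The hybrid scheme\<close>

lemma norm_convex_combination_sq_le:
  fixes u v :: "'a::real_inner"
  assumes "0 \<le> t" "t \<le> 1"
  shows "(norm (t *\<^sub>R u + (1 - t) *\<^sub>R v))\<^sup>2 \<le> t * (norm u)\<^sup>2 + (1 - t) * (norm v)\<^sup>2"
proof -
  have "t * (norm u)\<^sup>2 + (1 - t) * (norm v)\<^sup>2 - (norm (t *\<^sub>R u + (1 - t) *\<^sub>R v))\<^sup>2
      = t * (1 - t) * (norm (u - v))\<^sup>2"
    by (simp add: power2_norm_eq_inner inner_diff inner_add inner_commute algebra_simps)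
  moreover have "0 \<le> t * (1 - t) * (norm (u - v))\<^sup>2" using assms by simp
  ultimately show ?thesis by linarith
qed

text \<open>Converts triangle inequality bounds into the difference of squares on the right of the
  extragradient estimate.\<close>

lemma norm_sq_diff_le:
  fixes a b s :: "'a::real_normed_vector"
  assumes "norm (a - s) - norm (b - s) \<le> e" "0 \<le> e" "norm (a - s) \<le> D" "norm (b - s) \<le> D"
  shows "(norm (a - s))\<^sup>2 - (norm (b - s))\<^sup>2 \<le> 2 * D * e"
proof -
  have "(norm (a - s))\<^sup>2 - (norm (b - s))\<^sup>2
      = (norm (a - s) - norm (b - s)) * (norm (a - s) + norm (b - s))"
    by (simp add: power2_eq_square algebra_simps)
  also have "\<dots> \<le> e * (norm (a - s) + norm (b - s))" using assms by (intro mult_right_mono) auto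
  also have "\<dots> \<le> e * (2 * D)" using assms by (intro mult_left_mono) auto
  finally show ?thesis by (simp add: mult.commute)
qed

text \<open>The quadratic terms in \<open>v\<close> cancel, so that \<open>cut_C\<close> is cut out of \<open>C\<close> by a half-space.\<close>

lemma cut_C_eq: "cut_C C x\<^sub>0 t x u = C \<inter> {v. inner (2 *\<^sub>R (t *\<^sub>R x\<^sub>0 + (1 - t) *\<^sub>R x - u)) v
    \<le> t * (norm x\<^sub>0)\<^sup>2 + (1 - t) * (norm x)\<^sup>2 - (norm u)\<^sup>2}"
proof -
  have "(norm (u - v))\<^sup>2 \<le> t * (norm (x\<^sub>0 - v))\<^sup>2 + (1 - t) * (norm (x - v))\<^sup>2 \<longleftrightarrow>
      inner (2 *\<^sub>R (t *\<^sub>R x\<^sub>0 + (1 - t) *\<^sub>R x - u)) v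
        \<le> t * (norm x\<^sub>0)\<^sup>2 + (1 - t) * (norm x)\<^sup>2 - (norm u)\<^sup>2" for v
    by (simp add: norm_diff_sq inner_add_left inner_diff_left algebra_simps)
  then show ?thesis by (auto simp: cut_C_def)
qed

lemma cut_Q_eq: "cut_Q C x\<^sub>0 x = C \<inter> {v. inner (x\<^sub>0 - x) v \<le> inner (x\<^sub>0 - x) x}"
  by (auto simp: cut_Q_def inner_diff_right)

lemma closed_convex_cuts:
  assumes "closed C" "convex C"
  shows "closed (cut_C C x\<^sub>0 t x u \<inter> cut_Q C x\<^sub>0 x)" "convex (cut_C C x\<^sub>0 t x u \<inter> cut_Q C x\<^sub>0 x)"
  unfolding cut_C_eq cut_Q_eq
  by (intro closed_Int convex_Int assms closed_halfspace_le convex_halfspace_le)+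

theorem theorem2:
  fixes C :: "'a::{real_inner, complete_space} set"
    and f :: "nat \<Rightarrow> 'a \<Rightarrow> 'a \<Rightarrow> ereal"
    and S :: "nat \<Rightarrow> 'a \<Rightarrow> 'a"
    and N M :: nat
    and c\<^sub>1 c\<^sub>2 \<rho> :: real
    and \<alpha> :: "nat \<Rightarrow> real"
    and x\<^sub>0 :: 'a
    and x :: "nat \<Rightarrow> 'a"
    and F :: "'a set"
  assumes "C \<noteq> {}" "closed C" "convex C"
    and "N \<ge> 1" "M \<ge> 1"
    and "c\<^sub>1 > 0" "c\<^sub>2 > 0"
    and "\<And>i. i \<in> {1..N} \<Longrightarrow> bifunction_on C (f i)"
    and "\<And>i. i \<in> {1..N} \<Longrightarrow> pseudomonotone_on C (f i)"
    and "\<And>i. i \<in> {1..N} \<Longrightarrow> lipschitz_type_on c\<^sub>1 c\<^sub>2 C (f i)"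
    and "\<And>i. i \<in> {1..N} \<Longrightarrow> weakly_continuous_on C (f i)"
    and "\<And>i v. i \<in> {1..N} \<Longrightarrow> v \<in> C \<Longrightarrow> ereal_convex_on C (f i v)"
    and "\<And>i v. i \<in> {1..N} \<Longrightarrow> v \<in> C \<Longrightarrow> subdifferentiable_on C (f i v)"
    and "\<And>j. j \<in> {1..M} \<Longrightarrow> nonexpansive_on C (S j)"
    and F_def: "F = (\<Inter>i\<in>{1..N}. equilibria C (f i)) \<inter> (\<Inter>j\<in>{1..M}. fixed_points_on C (S j))"
    and "F \<noteq> {}"
    and "x\<^sub>0 \<in> C"
    and "0 < \<rho>" "\<rho> < min (1 / (2 * c\<^sub>1)) (1 / (2 * c\<^sub>2))"
    and "\<And>n. \<alpha> n \<in> {0<..<1}" "\<alpha> \<longlonglongrightarrow> 0"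
    and "halpern_extragradient C N f M S \<rho> \<alpha> x\<^sub>0 x"
  shows "x \<longlonglongrightarrow> metric_proj F x\<^sub>0"
proof -
  have eqb: "equilibrium_bifunction C (f i) c\<^sub>1 c\<^sub>2" if "i \<in> {1..N}" for i
    using that assms(2,8-13) by (simp add: equilibrium_bifunction_def)
  obtain y z u k l where x0: "x 0 = x\<^sub>0"
    and y: "\<And>n i. i \<in> {1..N} \<Longrightarrow>
      y n i = arg_min_on (\<lambda>v. ereal \<rho> * f i (x n) v + ereal (1/2 * (norm (x n - v))\<^sup>2)) C"
    and z: "\<And>n i. i \<in> {1..N} \<Longrightarrow>
      z n i = arg_min_on (\<lambda>v. ereal \<rho> * f i (y n i) v + ereal (1/2 * (norm (x n - v))\<^sup>2)) C"
    and k: "\<And>n. is_arg_max (\<lambda>i. norm (z n i - x n)) (\<lambda>i. i \<in> {1..N}) (k n)"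
    and u: "\<And>n j. j \<in> {1..M} \<Longrightarrow> u n j = \<alpha> n *\<^sub>R x\<^sub>0 + (1 - \<alpha> n) *\<^sub>R S j (z n (k n))"
    and l: "\<And>n. is_arg_max (\<lambda>j. norm (u n j - x n)) (\<lambda>j. j \<in> {1..M}) (l n)"
    and x_Suc: "\<And>n. x (Suc n) = metric_proj
      (cut_C C x\<^sub>0 (\<alpha> n) (x n) (u n (l n)) \<inter> cut_Q C x\<^sub>0 (x n)) x\<^sub>0"
    using assms(22) unfolding halpern_extragradient_def by blast
  define zb where "zb n = z n (k n)" for n
  define ub where "ub n = u n (l n)" for n
  define K where "K n = cut_C C x\<^sub>0 (\<alpha> n) (x n) (ub n) \<inter> cut_Q C x\<^sub>0 (x n)" for n
  have kN: "k n \<in> {1..N}" and z_le: "i \<in> {1..N} \<Longrightarrow> norm (z n i - x n) \<le> norm (zb n - x n)"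
    and lM: "l n \<in> {1..M}" and u_le: "j \<in> {1..M} \<Longrightarrow> norm (u n j - x n) \<le> norm (ub n - x n)"
    for n i j using k[of n] l[of n] by (auto simp: is_arg_max_linorder zb_def ub_def)
  have \<alpha>: "0 < \<alpha> n" "\<alpha> n < 1" for n using assms(20)[of n] by auto
  \<comment> \<open>The bound on \<rho> says precisely that both coefficients of the extragradient
    estimate are positive; \<kappa> is the smaller one.\<close>
  define \<kappa> where "\<kappa> = min (1 - 2 * \<rho> * c\<^sub>1) (1 - 2 * \<rho> * c\<^sub>2)"
  have \<kappa>: "0 < \<kappa>" using assms(6,7,19) by (simp add: \<kappa>_def field_simps)
  have SC: "S j v \<in> C" and S_le: "w \<in> C \<Longrightarrow> norm (S j v - S j w) \<le> norm (v - w)"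
    if "j \<in> {1..M}" "v \<in> C" for j v w
    using assms(14)[OF that(1)] that(2) by (auto simp: nonexpansive_on_def)
  have F: "s \<in> C" "i \<in> {1..N} \<Longrightarrow> s \<in> equilibria C (f i)" "j \<in> {1..M} \<Longrightarrow> S j s = s"
    if "s \<in> F" for s i j
    using that assms(5) unfolding F_def fixed_points_on_def by auto
  have z_in: "z n i \<in> C" and estimate: "s \<in> F \<Longrightarrow>
      \<kappa> * ((norm (x n - y n i))\<^sup>2 + (norm (y n i - z n i))\<^sup>2)
        \<le> (norm (x n - s))\<^sup>2 - (norm (z n i - s))\<^sup>2"
    if "x n \<in> C" "i \<in> {1..N}" for n i s
  proof -
    interpret equilibrium_bifunction C "f i" c\<^sub>1 c\<^sub>2 using eqb that(2) .
    have y': "y n i = prox \<rho> (x n) (x n)" using y[OF that(2)] by (simp add: prox_def)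
    have z': "z n i = prox \<rho> (prox \<rho> (x n) (x n)) (x n)"
      using z[OF that(2), of n] unfolding y' by (simp add: prox_def)
    show "z n i \<in> C" unfolding z' by (intro prox_in that(1) assms(18))
    assume "s \<in> F"
    have "\<kappa> * (norm (x n - y n i))\<^sup>2 \<le> (1 - 2 * \<rho> * c\<^sub>1) * (norm (x n - y n i))\<^sup>2"
      "\<kappa> * (norm (y n i - z n i))\<^sup>2 \<le> (1 - 2 * \<rho> * c\<^sub>2) * (norm (y n i - z n i))\<^sup>2"
      by (intro mult_right_mono; simp add: \<kappa>_def)+
    then show "\<kappa> * ((norm (x n - y n i))\<^sup>2 + (norm (y n i - z n i))\<^sup>2)
        \<le> (norm (x n - s))\<^sup>2 - (norm (z n i - s))\<^sup>2"
      using extragradient_estimate[OF that(1) F(2)[OF \<open>s \<in> F\<close> that(2)] assms(18)]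
      unfolding z'[symmetric] unfolding y'[symmetric] by (simp add: distrib_left)
  qed
  have z_fejer: "norm (z n i - s) \<le> norm (x n - s)" if "x n \<in> C" "i \<in> {1..N}" "s \<in> F" for n i s
  proof (rule power2_le_imp_le)
    have "0 \<le> \<kappa> * ((norm (x n - y n i))\<^sup>2 + (norm (y n i - z n i))\<^sup>2)" using \<kappa> by simp
    then show "(norm (z n i - s))\<^sup>2 \<le> (norm (x n - s))\<^sup>2" using estimate[OF that] by linarith
  qed simp
  have F_cut_C: "F \<subseteq> cut_C C x\<^sub>0 (\<alpha> n) (x n) (ub n)" if "x n \<in> C" for n
  proof
    fix s assume s: "s \<in> F"
    have "norm (S (l n) (zb n) - s) \<le> norm (zb n - s)"
      using S_le[OF lM z_in[OF that kN] F(1)[OF s]] F(3)[OF s lM] by (simp add: zb_def)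
    also have "\<dots> \<le> norm (x n - s)" unfolding zb_def by (rule z_fejer[OF that kN s])
    finally have le: "(1 - \<alpha> n) * (norm (S (l n) (zb n) - s))\<^sup>2 \<le> (1 - \<alpha> n) * (norm (x n - s))\<^sup>2"
      using \<alpha>[of n] by (intro mult_left_mono power_mono) auto
    have "ub n - s = \<alpha> n *\<^sub>R (x\<^sub>0 - s) + (1 - \<alpha> n) *\<^sub>R (S (l n) (zb n) - s)"
      unfolding ub_def u[OF lM] zb_def by (simp add: algebra_simps)
    then have "(norm (ub n - s))\<^sup>2
        \<le> \<alpha> n * (norm (x\<^sub>0 - s))\<^sup>2 + (1 - \<alpha> n) * (norm (S (l n) (zb n) - s))\<^sup>2"
      using norm_convex_combination_sq_le[of "\<alpha> n" "x\<^sub>0 - s" "S (l n) (zb n) - s"] \<alpha>[of n] by simp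
    then show "s \<in> cut_C C x\<^sub>0 (\<alpha> n) (x n) (ub n)"
      using le F(1)[OF s] by (simp add: cut_C_def)
  qed
  have closed_convex_K: "closed (K n)" "convex (K n)" for n
    unfolding K_def by (intro closed_convex_cuts assms(2,3))+
  have x_metric_proj: "x (Suc n) = metric_proj (K n) x\<^sub>0" for n
    unfolding x_Suc K_def ub_def ..
  \<comment> \<open>At 0 the normal vector \<open>x\<^sub>0 - x 0\<close> is zero, so
    \<open>cut_Q\<close> is all of \<open>C\<close>. In the step, \<open>F \<subseteq> K n\<close>
    makes \<open>K n\<close> nonempty, so the projection is genuine, and its obtuse angle property
    for points of \<open>F\<close> is the next inclusion in \<open>cut_Q\<close>.\<close>
  have invariant: "x n \<in> C \<and> F \<subseteq> cut_Q C x\<^sub>0 (x n)" for n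
  proof (induction n)
    case 0
    show ?case using assms(17) F(1) by (auto simp: x0 cut_Q_def)
  next
    case (Suc n)
    then have FK: "F \<subseteq> K n" using F_cut_C by (simp add: K_def)
    then have ne: "K n \<noteq> {}" using assms(16) by blast
    show ?case
      using metric_proj_in[OF closed_convex_K ne, of x\<^sub>0] FK F(1)
        metric_proj_obtuse[OF closed_convex_K ne, of _ x\<^sub>0] unfolding x_metric_proj[symmetric]
      by (auto simp: cut_Q_def K_def)
  qed
  then have xC: "x n \<in> C" and F_cut_Q: "F \<subseteq> cut_Q C x\<^sub>0 (x n)" for n by auto
  have obtuse: "inner (x\<^sub>0 - x n) (s - x n) \<le> 0" if "s \<in> F" for s n
    using F_cut_Q[of n] that by (auto simp: cut_Q_def)
  have x_Suc_K: "x (Suc n) \<in> K n" for n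
  proof -
    have "K n \<noteq> {}" using F_cut_C[OF xC] F_cut_Q[of n] assms(16) unfolding K_def by blast
    then show ?thesis unfolding x_metric_proj by (intro metric_proj_in closed_convex_K)
  qed
  obtain s where s: "s \<in> F" using assms(16) by blast
  define D where "D = norm (x\<^sub>0 - s)"
  \<comment> \<open>Used twice: \<open>v = s\<close> bounds the iterates, and
    \<open>v = x (Suc n)\<close> bounds each step by the increase of the squared distance to
    \<open>x\<^sub>0\<close>.\<close>
  have pyth: "(norm (x\<^sub>0 - x n))\<^sup>2 + (norm (x n - v))\<^sup>2 \<le> (norm (x\<^sub>0 - v))\<^sup>2"
    if "v \<in> cut_Q C x\<^sub>0 (x n)" for v n
    using that by (simp add: cut_Q_def power2_norm_eq_inner inner_diff inner_commute)
  have bound_s: "norm (x n - s) \<le> D" and bound_0: "norm (x\<^sub>0 - x n) \<le> D" for n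
  proof -
    have "(norm (x\<^sub>0 - x n))\<^sup>2 + (norm (x n - s))\<^sup>2 \<le> D\<^sup>2"
      unfolding D_def using pyth F_cut_Q s by blast
    then have "(norm (x n - s))\<^sup>2 \<le> D\<^sup>2" "(norm (x\<^sub>0 - x n))\<^sup>2 \<le> D\<^sup>2"
      by (smt (verit) zero_le_power2)+
    then show "norm (x n - s) \<le> D" "norm (x\<^sub>0 - x n) \<le> D"
      by (auto intro: power2_le_imp_le simp: D_def)
  qed
  have pyth_Suc: "(norm (x\<^sub>0 - x n))\<^sup>2 + (norm (x n - x (Suc n)))\<^sup>2
      \<le> (norm (x\<^sub>0 - x (Suc n)))\<^sup>2" for n
    using pyth x_Suc_K unfolding K_def by blast
  have "incseq (\<lambda>n. (norm (x\<^sub>0 - x n))\<^sup>2)"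
  proof (rule incseq_SucI)
    show "(norm (x\<^sub>0 - x n))\<^sup>2 \<le> (norm (x\<^sub>0 - x (Suc n)))\<^sup>2" for n
      using pyth_Suc[of n] zero_le_power2[of "norm (x n - x (Suc n))"] by linarith
  qed
  moreover have "\<forall>n. (norm (x\<^sub>0 - x n))\<^sup>2 \<le> D\<^sup>2" using bound_0 by (simp add: power_mono)
  ultimately obtain d where d: "(\<lambda>n. (norm (x\<^sub>0 - x n))\<^sup>2) \<longlonglongrightarrow> d"
    using incseq_convergent by blast
  have "(\<lambda>n. (norm (x n - x (Suc n)))\<^sup>2) \<longlonglongrightarrow> 0"
  proof (rule tendsto_sandwich[OF _ _ tendsto_const[of 0]])
    show "(\<lambda>n. (norm (x\<^sub>0 - x (Suc n)))\<^sup>2 - (norm (x\<^sub>0 - x n))\<^sup>2) \<longlonglongrightarrow> 0"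
      using tendsto_diff[OF LIMSEQ_Suc[OF d] d] by simp
    show "\<forall>\<^sub>F n in sequentially.
        (norm (x n - x (Suc n)))\<^sup>2 \<le> (norm (x\<^sub>0 - x (Suc n)))\<^sup>2 - (norm (x\<^sub>0 - x n))\<^sup>2"
      using pyth_Suc by (simp add: algebra_simps)
  qed simp
  note step_sq = this
  have step: "(\<lambda>n. norm (x n - x (Suc n))) \<longlonglongrightarrow> 0" using tendsto_real_sqrt[OF step_sq] by simp
  have "(\<lambda>n. (norm (ub n - x (Suc n)))\<^sup>2) \<longlonglongrightarrow> 0"
  proof (rule tendsto_sandwich[OF _ _ tendsto_const[of 0]])
    show "(\<lambda>n. \<alpha> n * D\<^sup>2 + (norm (x n - x (Suc n)))\<^sup>2) \<longlonglongrightarrow> 0"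
      using tendsto_add[OF tendsto_mult_right[OF assms(21), of "D\<^sup>2"] step_sq] by simp
    have "(norm (ub n - x (Suc n)))\<^sup>2 \<le> \<alpha> n * D\<^sup>2 + (norm (x n - x (Suc n)))\<^sup>2" for n
    proof -
      have "(norm (ub n - x (Suc n)))\<^sup>2
          \<le> \<alpha> n * (norm (x\<^sub>0 - x (Suc n)))\<^sup>2 + (1 - \<alpha> n) * (norm (x n - x (Suc n)))\<^sup>2"
        using x_Suc_K[of n] by (simp add: K_def cut_C_def)
      also have "\<dots> \<le> \<alpha> n * D\<^sup>2 + 1 * (norm (x n - x (Suc n)))\<^sup>2"
        using \<alpha>[of n] bound_0[of "Suc n"]
        by (intro add_mono mult_left_mono mult_right_mono power_mono) auto
      finally show ?thesis by simp
    qed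
    then show "\<forall>\<^sub>F n in sequentially.
        (norm (ub n - x (Suc n)))\<^sup>2 \<le> \<alpha> n * D\<^sup>2 + (norm (x n - x (Suc n)))\<^sup>2" by simp
  qed simp
  from tendsto_real_sqrt[OF this] have ub_step: "(\<lambda>n. norm (ub n - x (Suc n))) \<longlonglongrightarrow> 0" by simp
  \<comment> \<open>An error valid for all \<open>j\<close> at once: maximality of
    \<open>l n\<close> replaces \<open>u n j\<close> by \<open>ub n\<close>, the first two terms are
    the detour over \<open>x (Suc n)\<close>, and \<open>2 * D\<close> bounds the distance from
    \<open>x\<^sub>0\<close> to \<open>S j (zb n)\<close> in the Halpern term.\<close>
  define e where
    "e n = norm (ub n - x (Suc n)) + norm (x n - x (Suc n)) + \<alpha> n * (2 * D)" for n
  have e: "e \<longlonglongrightarrow> 0"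
    using tendsto_add[OF tendsto_add[OF ub_step step] tendsto_mult_right[OF assms(21), of "2 * D"]]
    unfolding e_def by simp
  have zbC: "zb n \<in> C" and zb_s: "norm (zb n - s) \<le> norm (x n - s)" for n
    unfolding zb_def using z_in z_fejer xC kN s by blast+
  have S_zb_s: "norm (S j (zb n) - s) \<le> norm (zb n - s)" if "j \<in> {1..M}" for j n
    using S_le[OF that zbC F(1)[OF s]] F(3)[OF s that] by simp
  have S_zb: "norm (S j (zb n) - x n) \<le> e n" if j: "j \<in> {1..M}" for j n
  proof -
    have "norm (x\<^sub>0 - S j (zb n)) \<le> 2 * D"
      using norm_triangle_ineq4[of "x\<^sub>0 - s" "S j (zb n) - s"] S_zb_s[OF j, of n] zb_s[of n]
        bound_s[of n] by (simp add: D_def)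
    then have "\<alpha> n * norm (x\<^sub>0 - S j (zb n)) \<le> \<alpha> n * (2 * D)"
      using \<alpha>[of n] by (intro mult_left_mono) auto
    moreover have eq: "S j (zb n) - x n = (u n j - x n) - \<alpha> n *\<^sub>R (x\<^sub>0 - S j (zb n))"
      by (simp add: u[OF j] zb_def algebra_simps)
    have "norm (S j (zb n) - x n) \<le> norm (u n j - x n) + \<alpha> n * norm (x\<^sub>0 - S j (zb n))"
      using norm_triangle_ineq4[of "u n j - x n" "\<alpha> n *\<^sub>R (x\<^sub>0 - S j (zb n))", folded eq] \<alpha>[of n]
      by simp
    moreover have "norm (ub n - x n) \<le> norm (ub n - x (Suc n)) + norm (x n - x (Suc n))"
      using norm_triangle_ineq4[of "ub n - x (Suc n)" "x n - x (Suc n)"] by simp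
    ultimately show ?thesis using u_le[OF j, of n] by (simp add: e_def)
  qed
  have e0: "0 \<le> e n" for n
    by (rule order_trans[OF norm_ge_zero S_zb[OF lM]])
  \<comment> \<open>Passing through \<open>S (l n) (zb n)\<close> shows that the distance to
    \<open>s\<close> drops by at most \<open>e n\<close>. The 4 is a factor 2 from the difference of
    squares times a factor 2 from the parallelogram law.\<close>
  have zb_sq: "(norm (zb n - x n))\<^sup>2 \<le> 4 * D * e n / \<kappa>" for n
  proof -
    let ?a = "x n - y n (k n)" and ?b = "y n (k n) - zb n"
    have "norm (x n - s) - norm (zb n - s) \<le> e n"
      using norm_triangle_ineq[of "x n - S (l n) (zb n)" "S (l n) (zb n) - s"]
        S_zb[OF lM, of n n] S_zb_s[OF lM, of n n] by (simp add: norm_minus_commute)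
    then have "(norm (x n - s))\<^sup>2 - (norm (zb n - s))\<^sup>2 \<le> 2 * D * e n"
      using e0 bound_s[of n] zb_s[of n] by (intro norm_sq_diff_le) auto
    then have "\<kappa> * ((norm ?a)\<^sup>2 + (norm ?b)\<^sup>2) \<le> 2 * D * e n"
      using estimate[OF xC kN s, of n n] unfolding zb_def by linarith
    moreover have "(norm (zb n - x n))\<^sup>2 \<le> 2 * ((norm ?a)\<^sup>2 + (norm ?b)\<^sup>2)"
    proof -
      have "(norm (zb n - x n))\<^sup>2 = (norm (?a + ?b))\<^sup>2" by (simp add: norm_minus_commute)
      also have "\<dots> \<le> (norm (?a + ?b))\<^sup>2 + (norm (?a - ?b))\<^sup>2" by simp
      also have "\<dots> = 2 * ((norm ?a)\<^sup>2 + (norm ?b)\<^sup>2)"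
        unfolding power2_norm_eq_inner inner_add inner_diff by simp
      finally show ?thesis .
    qed
    then have "\<kappa> * (norm (zb n - x n))\<^sup>2 \<le> \<kappa> * (2 * ((norm ?a)\<^sup>2 + (norm ?b)\<^sup>2))"
      using \<kappa> by (intro mult_left_mono) auto
    ultimately show ?thesis using \<kappa> by (simp add: field_simps)
  qed
  have "(\<lambda>n. (norm (zb n - x n))\<^sup>2) \<longlonglongrightarrow> 0"
  proof (rule tendsto_sandwich[OF _ _ tendsto_const[of 0]])
    show "(\<lambda>n. 4 * D * e n / \<kappa>) \<longlonglongrightarrow> 0"
      using tendsto_divide[OF tendsto_mult_left[OF e, of "4 * D"] tendsto_const[of \<kappa>]] \<kappa> by simp
  qed (simp_all add: zb_sq)
  from tendsto_real_sqrt[OF this] have zb: "(\<lambda>n. norm (zb n - x n)) \<longlonglongrightarrow> 0" by simp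
  \<comment> \<open>The estimate for \<open>zb n\<close> concerns only the index \<open>k n\<close>.
    Maximality makes \<open>z n i - x n\<close> small for every \<open>i\<close>, and a second use
    of the extragradient estimate then reaches \<open>y n i\<close>.\<close>
  have asym_y: "(\<lambda>n. x n - y n i) \<longlonglongrightarrow> 0" if i: "i \<in> {1..N}" for i
  proof -
    have "(norm (x n - y n i))\<^sup>2 \<le> 2 * D * norm (zb n - x n) / \<kappa>" for n
    proof -
      have "norm (x n - s) - norm (z n i - s) \<le> norm (zb n - x n)"
        using norm_triangle_ineq[of "x n - z n i" "z n i - s"] z_le[OF i, of n]
        by (simp add: norm_minus_commute)
      then have "(norm (x n - s))\<^sup>2 - (norm (z n i - s))\<^sup>2 \<le> 2 * D * norm (zb n - x n)"
        using bound_s[of n] z_fejer[OF xC i s, of n] by (intro norm_sq_diff_le) auto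
      moreover have "\<kappa> * (norm (x n - y n i))\<^sup>2
          \<le> \<kappa> * ((norm (x n - y n i))\<^sup>2 + (norm (y n i - z n i))\<^sup>2)"
        using \<kappa> by (intro mult_left_mono) auto
      ultimately have "\<kappa> * (norm (x n - y n i))\<^sup>2 \<le> 2 * D * norm (zb n - x n)"
        using estimate[OF xC i s, of n] by linarith
      then show ?thesis using \<kappa> by (simp add: field_simps)
    qed
    note le = this
    have "(\<lambda>n. (norm (x n - y n i))\<^sup>2) \<longlonglongrightarrow> 0"
    proof (rule tendsto_sandwich[OF _ _ tendsto_const[of 0]])
      show "(\<lambda>n. 2 * D * norm (zb n - x n) / \<kappa>) \<longlonglongrightarrow> 0"
        using tendsto_divide[OF tendsto_mult_left[OF zb, of "2 * D"] tendsto_const[of \<kappa>]] \<kappa> by simp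
    qed (simp_all add: le)
    from tendsto_real_sqrt[OF this] show ?thesis by (simp add: tendsto_norm_zero_iff)
  qed
  have asym_S: "(\<lambda>n. x n - S j (x n)) \<longlonglongrightarrow> 0" if j: "j \<in> {1..M}" for j
  proof (rule Lim_null_comparison)
    show "(\<lambda>n. e n + norm (zb n - x n)) \<longlonglongrightarrow> 0" using tendsto_add[OF e zb] by simp
    have "norm (x n - S j (x n)) \<le> e n + norm (zb n - x n)" for n
      using norm_triangle_ineq4[of "S j (x n) - S j (zb n)" "x n - S j (zb n)"]
        S_le[OF j xC zbC, of n n] S_zb[OF j, of n] by (simp add: norm_minus_commute)
    then show "\<forall>\<^sub>F n in sequentially. norm (x n - S j (x n)) \<le> e n + norm (zb n - x n)" by simp
  qed
  have bdd: "bounded (range x)"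
    by (rule bounded_subset[OF bounded_cball[of x\<^sub>0 D]]) (auto simp: dist_norm bound_0)
  show ?thesis
  proof (rule tendsto_metric_proj_if_weak_cluster_points[OF bdd obtuse])
    fix r :: "nat \<Rightarrow> nat" and q assume r: "strict_mono r" and q: "weakly_tendsto (x \<circ> r) q"
    have range: "range (x \<circ> r) \<subseteq> C" using xC by auto
    have bdd_r: "bounded (range (x \<circ> r))" using bdd by (rule bounded_subset) auto
    have qC: "q \<in> C" using closed_convex_weak_limit[OF assms(2,3) range q] .
    have "q \<in> equilibria C (f i)" if i: "i \<in> {1..N}" for i
    proof -
      interpret equilibrium_bifunction C "f i" c\<^sub>1 c\<^sub>2 using eqb i .
      have "x (r n) - y (r n) i = (x \<circ> r) n - prox \<rho> ((x \<circ> r) n) ((x \<circ> r) n)" for n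
        using y[OF i, of "r n"] by (simp add: prox_def)
      then show ?thesis
        using weak_limit_equilibrium[OF range bdd_r q assms(18)]
          LIMSEQ_subseq_LIMSEQ[OF asym_y[OF i] r] by (simp add: comp_def)
    qed
    moreover have "S j q = q" if j: "j \<in> {1..M}" for j
      using nonexpansive_demiclosed[OF assms(14)[OF j] range bdd_r q qC]
        LIMSEQ_subseq_LIMSEQ[OF asym_S[OF j] r] by (simp add: comp_def)
    ultimately show "q \<in> F" using qC by (simp add: F_def fixed_points_on_def)
  qed
qed

end
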